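(* Let $m\ge1$, $n=2m$, $q=2^m$, let $\omega$ be a primitive element of $\mathbb{F}_{q^2}$ and $u=\omega^{(q-1)(2^{n-1}-1)}$ (a generator of $\mu_{q+1}$; the cosets $u^i\mathbb{F}_q^*$, $i\in\mathbb{Z}_{q+1}$, partition $\mathbb{F}_{q^2}^*$). Let $a_i\in\mathbb{F}_{q^2}$ and integers $0\le s_i\le q$ for $i\in\mathbb{Z}_{q+1}$. Define $f(0)=0$ and $f(x)={\rm Tr}_1^n(a_ix^{s_i(q-1)+1})$ if $x\in u^i\mathbb{F}_q^*$, $i\in\mathbb{Z}_{q+1}$. Let $\alpha_i=a_iu^{i(1-2s_i)}+a_i^qu^{i(2s_i-1)}$ and for $b\in\mathbb{F}_{q^2}$ let $T_i(b)=1$ if $bu^i+b^qu^{-i}=\alpha_i$ and $T_i(b)=0$ otherwise. Then for every $b\in\mathbb{F}_{q^2}$, $\widehat f(b)=q\big(\sum_{i\in\mathbb{Z}_{q+1}}T_i(b)-1\big)$. Moreover, $f$ is bent if and only if $\sum_{i\in\mathbb{Z}_{q+1}}T_i(b)\in\{0,2\}$ for every $b\in\mathbb{F}_{q^2}$.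
   Context: ${\rm Tr}_1^k$ is the absolute trace of $\mathbb{F}_{2^k}$, $\mu_e=\{x:x^e=1\}$. Walsh transform $\widehat f(b)=\sum_{x\in\mathbb{F}_{q^2}}(-1)^{f(x)+{\rm Tr}_1^n(bx)}$; $f$ is bent iff $|\widehat f(b)|=2^{n/2}$ for all $b$. *)

theory Defs
  imports
    "HOL-Library.Z2"
    "HOL-Library.Cardinality"
    "HOL-Library.Disjoint_Sets"
    "HOL-Computational_Algebra.Computational_Algebra"
    Complex_Main
begin

definition primitive_element :: "'a::finite_field \<Rightarrow> bool" where
  "primitive_element w \<longleftrightarrow> range (\<lambda>k::nat. w ^ k) = - {0}"

definition mu :: "nat \<Rightarrow> 'a::finite_field set" where
  "mu e = {x. x ^ e = 1}"

text \<open>The subfield of order \<open>q\<close>, realised as the set of fixed points of \<open>x \<mapsto> x ^ q\<close>. It is only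
  meant for ambient fields whose order is a power of \<open>q\<close>.\<close>

definition subfield_of_order :: "nat \<Rightarrow> 'a::finite_field set" where
  "subfield_of_order q = {x. x ^ q = x}"

definition mult_coset :: "nat \<Rightarrow> 'a::finite_field \<Rightarrow> 'a set" where
  "mult_coset q v = (\<lambda>y. v * y) ` (subfield_of_order q - {0})"

text \<open>The absolute trace \<open>x + x\<^sup>2 + x\<^sup>4 + \<dots> + x ^ 2 ^ (k - 1)\<close> of a field \<open>'a\<close> with \<open>2 ^ k\<close> elements.
  In such a field the sum lies in the prime subfield \<open>{0, 1}\<close>, which is identified here
  with the two-element field \<open>bit\<close>.\<close>

definition abs_trace :: "nat \<Rightarrow> 'a::finite_field \<Rightarrow> bit" where
  "abs_trace k x = (if (\<Sum>j<k. x ^ (2 ^ j)) = 0 then 0 else 1)"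

text \<open>In both of the following definitions \<open>n\<close> is the extension degree, that is,
  \<open>CARD('a) = 2 ^ n\<close>. The sum in the exponent of \<open>-1\<close> is taken in \<open>bit\<close>.\<close>

definition walsh :: "nat \<Rightarrow> ('a::finite_field \<Rightarrow> bit) \<Rightarrow> 'a \<Rightarrow> int" where
  "walsh n f b = (\<Sum>x\<in>UNIV. (- 1) ^ (of_bool (f x + abs_trace n (b * x) = 1) :: nat))"

definition bent :: "nat \<Rightarrow> ('a::finite_field \<Rightarrow> bit) \<Rightarrow> bool" where
  "bent n f \<longleftrightarrow> (\<forall>b. \<bar>real_of_int (walsh n f b)\<bar> = 2 powr (real n / 2))"

end

theory Submission
  imports Defs
begin

text \<open>
  On a coset \<open>u ^ i \<cdot> GF(q)\<^sup>*\<close> the function \<open>f(x) + Tr(b x)\<close> is additive: writing \<open>x = u ^ i y\<close> with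
  \<open>y ^ q = y\<close>, and using \<open>u ^ q = 1 / u\<close>, it equals \<open>Tr(c y)\<close> for a constant \<open>c\<close> with
  \<open>c + c ^ q = \<alpha>\<^sub>i + b u ^ i + b ^ q u ^ (-i)\<close>. The additive character \<open>y \<mapsto> (-1) ^ Tr(c y)\<close> of
  \<open>GF(q)\<close> is trivial iff the relative trace \<open>c + c ^ q\<close> vanishes, because
  \<open>Tr(c y) = (\<Sum>j<m. ((c + c ^ q) y) ^ 2 ^ j)\<close> is a polynomial in \<open>y\<close> of degree less than \<open>q\<close>.
  Hence the coset contributes \<open>q T\<^sub>i(b) - 1\<close> to the Walsh sum.
\<close>

section \<open>Signs of bits and arithmetic in characteristic two\<close>

definition bit_sign :: "bit \<Rightarrow> int" where
  "bit_sign z = (- 1) ^ (of_bool (z = 1) :: nat)"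

lemma bit_sign_0 [simp]: "bit_sign 0 = 1"
  and bit_sign_1 [simp]: "bit_sign 1 = - 1"
  by (simp_all add: bit_sign_def)

lemma bit_sign_add: "bit_sign (x + y) = bit_sign x * bit_sign y"
  by (cases x; cases y) simp_all

lemma walsh_eq_sum_bit_sign:
  "walsh n f b = (\<Sum>x\<in>UNIV. bit_sign (f x + abs_trace n (b * x)))"
  by (simp add: walsh_def bit_sign_def)

text \<open>Every element is fixed by the power \<open>CARD('a)\<close>; for \<open>- 1\<close> and
  an even exponent this reads \<open>1 = - 1\<close>.\<close>

lemma CHAR_eq_2_if_even_card:
  assumes "even CARD('a::finite_field)"
  shows "CHAR('a) = 2"
proof -
  have "(1::'a) = (- 1) ^ CARD('a)"
    using assms by simp
  also have "\<dots> = - 1"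
    by (rule finite_field_power_card_eq_same)
  finally have "of_nat 2 = (0::'a)"
    by (simp add: eq_neg_iff_add_eq_0)
  then have "CHAR('a) dvd 2"
    by (simp only: of_nat_eq_0_iff_char_dvd)
  then show ?thesis
    using CHAR_prime[where 'a = 'a] primes_dvd_imp_eq two_is_prime_nat by blast
qed

lemma add_eq_0_iff_CHAR_2:
  fixes x y :: "'a::ring_1"
  assumes "CHAR('a) = 2"
  shows "x + y = 0 \<longleftrightarrow> x = y"
  using uminus_CHAR_2[OF assms] by (metis add_eq_0_iff)

lemma add_power_two_power:
  fixes x y :: "'a::comm_ring_1"
  assumes "CHAR('a) = 2"
  shows "(x + y) ^ (2 ^ j) = x ^ (2 ^ j) + y ^ (2 ^ j)"
proof (induction j)
  case (Suc j)
  have "(2::'a) = 0"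
    using assms of_nat_CHAR[where 'a = 'a] by simp
  then have "(v + w) ^ 2 = v ^ 2 + w ^ 2" for v w :: 'a
    by (simp add: power2_sum)
  then show ?case
    using Suc by (simp add: power_mult mult.commute[of 2])
qed simp

lemma sum_power_two_power:
  fixes g :: "'b \<Rightarrow> 'a::comm_ring_1"
  assumes "CHAR('a) = 2"
  shows "(\<Sum>i\<in>A. g i) ^ (2 ^ j) = (\<Sum>i\<in>A. g i ^ (2 ^ j))"
  by (induction A rule: infinite_finite_induct) (simp_all add: add_power_two_power[OF assms] power_0_left)

section \<open>The absolute trace and sums of signs\<close>

text \<open>Squaring permutes the summands cyclically, because \<open>x ^ (2 ^ n) = x\<close>. Hence
  the sum \<open>t\<close> satisfies \<open>t ^ 2 = t\<close>.\<close>

lemma trace_sum_cases: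
  fixes x :: "'a::finite_field"
  assumes "CARD('a) = 2 ^ n" and "n > 0"
  shows "(\<Sum>j<n. x ^ (2 ^ j)) = 0 \<or> (\<Sum>j<n. x ^ (2 ^ j)) = 1"
proof -
  define t where "t = (\<Sum>j<n. x ^ (2 ^ j))"
  have char: "CHAR('a) = 2"
    using assms by (intro CHAR_eq_2_if_even_card) simp
  have "t ^ 2 = (\<Sum>j<n. x ^ (2 ^ Suc j))"
    using sum_power_two_power[OF char, of "\<lambda>j. x ^ (2 ^ j)" "{..<n}" 1]
    by (simp add: t_def power_mult mult.commute[of 2])
  then have "x + t ^ 2 = (\<Sum>j<Suc n. x ^ (2 ^ j))"
    by (simp only: sum.lessThan_Suc_shift) simp
  also have "\<dots> = x + t"
    using finite_field_power_card_eq_same[of x] assms by (simp add: t_def)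
  finally have "t * (t - 1) = 0"
    by (simp add: power2_eq_square algebra_simps)
  then show ?thesis
    by (auto simp: t_def)
qed

text \<open>The case distinction in \<open>abs_trace\<close> respects sums only because the field
  sum takes no values besides 0 and 1 and \<open>1 + 1 = 0\<close> in the field.\<close>

lemma abs_trace_add:
  fixes x y :: "'a::finite_field"
  assumes "CARD('a) = 2 ^ n" and "n > 0"
  shows "abs_trace n (x + y) = abs_trace n x + abs_trace n y"
proof -
  have char: "CHAR('a) = 2"
    using assms by (intro CHAR_eq_2_if_even_card) simp
  have add: "(\<Sum>j<n. (x + y) ^ (2 ^ j)) = (\<Sum>j<n. x ^ (2 ^ j)) + (\<Sum>j<n. y ^ (2 ^ j))"
    by (simp add: add_power_two_power[OF char] sum.distrib)
  have "(1::'a) + 1 = 0"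
    using add_eq_0_iff_CHAR_2[OF char] by blast
  then show ?thesis
    using trace_sum_cases[OF assms, of x] trace_sum_cases[OF assms, of y]
    by (auto simp: abs_trace_def add)
qed

text \<open>Translation by \<open>z\<close> permutes \<open>A\<close> and flips every sign, so the
  sum equals its own negative.\<close>

lemma sum_bit_sign_additive:
  fixes A :: "'a::ab_group_add set"
  assumes closed: "\<And>x y. x \<in> A \<Longrightarrow> y \<in> A \<Longrightarrow> x + y \<in> A" "\<And>x. x \<in> A \<Longrightarrow> - x \<in> A"
    and add: "\<And>x y. h (x + y) = h x + h y"
    and z: "z \<in> A" "h z = 1"
  shows "(\<Sum>y\<in>A. bit_sign (h y)) = 0"
proof -
  have "(\<Sum>y\<in>A. bit_sign (h y)) = (\<Sum>y\<in>A. bit_sign (h (z + y)))"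
    by (rule sum.reindex_bij_witness[of _ "\<lambda>y. z + y" "\<lambda>y. - z + y"])
      (use closed(1)[OF closed(2)[OF z(1)]] closed(1)[OF z(1)] in simp_all)
  also have "\<dots> = - (\<Sum>y\<in>A. bit_sign (h y))"
    by (simp only: add z bit_sign_add) (simp add: sum_negf)
  finally show ?thesis
    by simp
qed

section \<open>The quadratic extension and the order of its primitive element\<close>

locale quadratic_extension =
  fixes m q n :: nat and \<omega> u :: "'a::finite_field"
  assumes m: "m \<ge> 1"
    and n: "n = 2 * m"
    and q: "q = 2 ^ m"
    and card: "CARD('a) = q ^ 2"
    and prim: "primitive_element \<omega>"
    and u: "u = \<omega> ^ ((q - 1) * (2 ^ (n - 1) - 1))"
begin

lemma card_2: "CARD('a) = 2 ^ n"
  by (simp add: card q n power_mult mult.commute)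

lemma n_pos: "n > 0"
  using m n by simp

lemma q_ge_2: "q \<ge> 2"
  using m q self_le_power[of 2 m] by simp

lemma even_q: "even q"
  using m q by simp

lemma char: "CHAR('a) = 2"
  using card even_q by (intro CHAR_eq_2_if_even_card) simp

lemma add_power_q: "(x + y) ^ q = x ^ q + (y::'a) ^ q"
  unfolding q by (rule add_power_two_power[OF char])

lemma card_units: "q ^ 2 - 1 = (q - 1) * (q + 1)"
  by (simp add: power2_eq_square algebra_simps diff_mult_distrib)

lemma omega_nonzero: "\<omega> \<noteq> 0"
proof
  assume "\<omega> = 0"
  then have "\<omega> ^ 1 = 0" by simp
  then show False
    using prim unfolding primitive_element_def by (metis ComplD insertI1 rangeI)
qed

lemma power_card_units: "x \<noteq> 0 \<Longrightarrow> (x::'a) ^ (q ^ 2 - 1) = 1"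
proof -
  assume x: "x \<noteq> 0"
  have "x * x ^ (q ^ 2 - 1) = x ^ Suc (q ^ 2 - 1)"
    by simp
  also have "Suc (q ^ 2 - 1) = q ^ 2"
    using q_ge_2 by simp
  also have "x ^ q ^ 2 = x * 1"
    using finite_field_power_card_eq_same[of x] card by simp
  finally show ?thesis
    using x by (simp only: mult_cancel_left) simp
qed

lemma omega_power_mod: "\<omega> ^ (k mod (q ^ 2 - 1)) = \<omega> ^ k"
proof -
  have "\<omega> ^ k = \<omega> ^ ((q ^ 2 - 1) * (k div (q ^ 2 - 1)) + k mod (q ^ 2 - 1))"
    by simp
  also have "\<dots> = \<omega> ^ (k mod (q ^ 2 - 1))"
    by (simp only: power_add power_mult power_card_units[OF omega_nonzero]) simp
  finally show ?thesis ..
qed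

text \<open>\<open>primitive_element\<close> ranges over all natural exponents; the powers of
  \<open>\<omega>\<close> repeat after \<open>q ^ 2 - 1\<close> steps, so one period
  suffices.\<close>

lemma units_eq: "- {0} = (\<lambda>k. \<omega> ^ k) ` {..<q ^ 2 - 1}"
proof -
  have "q ^ 2 - 1 > 0"
    using q_ge_2 power_mono[of 2 q 2] by simp
  then show ?thesis
    using prim omega_power_mod unfolding primitive_element_def
    by (metis (no_types, lifting) image_eqI image_subset_iff lessThan_iff mod_less_divisor
        rangeE rangeI subsetI subset_antisym)
qed

text \<open>The exponents are as many as the nonzero elements that they hit. This fixes the order of
  \<open>\<omega>\<close> as exactly \<open>q ^ 2 - 1\<close>.\<close>

lemma inj_on_omega: "inj_on (\<lambda>k. \<omega> ^ k) {..<q ^ 2 - 1}"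
proof (rule eq_card_imp_inj_on)
  have "card (- {0::'a}) = q ^ 2 - 1"
    by (simp add: Compl_eq_Diff_UNIV card)
  then show "card ((\<lambda>k. \<omega> ^ k) ` {..<q ^ 2 - 1}) = card {..<q ^ 2 - 1}"
    by (simp add: units_eq)
qed simp

lemma omega_power_eq_1_iff: "\<omega> ^ k = 1 \<longleftrightarrow> (q ^ 2 - 1) dvd k"
proof -
  have pos: "q ^ 2 - 1 > 0"
    using q_ge_2 power_mono[of 2 q 2] by simp
  have "\<omega> ^ k = 1 \<longleftrightarrow> \<omega> ^ (k mod (q ^ 2 - 1)) = \<omega> ^ 0"
    by (simp only: omega_power_mod power_0)
  also have "\<dots> \<longleftrightarrow> k mod (q ^ 2 - 1) = 0"
    using inj_on_eq_iff[OF inj_on_omega, of "k mod (q ^ 2 - 1)" 0] pos by simp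
  finally show ?thesis
    by (simp add: dvd_eq_mod_eq_0)
qed

section \<open>The group generated by \<open>u\<close>\<close>

text \<open>The inverse of \<open>2 ^ (n - 1) - 1\<close> modulo \<open>q + 1\<close> is \<open>2 q\<close>.\<close>

lemma exponent_inverse:
  "(q - 1) * (2 ^ (n - 1) - 1) * (2 * q) = (q ^ 2 - 1) * (q ^ 2 - q - 1) + (q - 1)"
proof -
  have 1: "2 * (2 ^ (n - 1)) = q ^ 2"
    using n_pos power_Suc[of "2::nat" "n - 1"] card_2 card by simp
  \<comment> \<open>Writing \<open>q = k + 2\<close> turns the truncated subtractions into
    polynomials in \<open>k\<close>. The identity behind the claim is
    \<open>(q ^ 2 - 2) * q = (q + 1) * (q ^ 2 - q - 1) + 1\<close>.\<close>
  obtain k where k: "q = k + 2"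
    using q_ge_2 by (metis add.commute le_Suc_ex)
  have "int (2 ^ (n - 1) - 1) = 2 ^ (n - 1) - 1"
    by (simp add: of_nat_diff)
  then have "2 * int (2 ^ (n - 1) - 1) = int q ^ 2 - 2"
    using arg_cong[OF 1, of int] by simp
  moreover have "int ((q - 1) * (2 ^ (n - 1) - 1) * (2 * q)) =
      int (q - 1) * (2 * int (2 ^ (n - 1) - 1)) * int q"
    by (simp only: of_nat_mult)
  moreover have "q ^ 2 - q - 1 = k ^ 2 + 3 * k + 1" "q ^ 2 - 1 = (k + 1) * (k + 3)" "q - 1 = k + 1"
    by (simp_all add: k power2_eq_square algebra_simps)
  ultimately have "int ((q - 1) * (2 ^ (n - 1) - 1) * (2 * q)) =
      int ((q ^ 2 - 1) * (q ^ 2 - q - 1) + (q - 1))"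
    by (simp only:) (simp add: k power2_eq_square algebra_simps)
  then show ?thesis
    by (simp only: of_nat_eq_iff)
qed

text \<open>As \<open>u\<close> is itself a power of \<open>\<omega> ^ (q - 1)\<close>, this shows
  that both generate the same group, which gives the order of \<open>u\<close> and its
  range.\<close>

lemma u_power_2q: "u ^ (2 * q) = \<omega> ^ (q - 1)"
proof -
  have "u ^ (2 * q) = \<omega> ^ ((q ^ 2 - 1) * (q ^ 2 - q - 1) + (q - 1))"
    by (simp only: u exponent_inverse flip: power_mult)
  also have "\<dots> = \<omega> ^ (q - 1)"
    by (simp only: power_add power_mult power_card_units[OF omega_nonzero]) simp
  finally show ?thesis .
qed

lemma u_nonzero: "u \<noteq> 0"
  using omega_nonzero u by simp

lemma u_power_Suc_q: "u ^ (q + 1) = 1"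
proof -
  have "u ^ (q + 1) = (\<omega> ^ (q ^ 2 - 1)) ^ (2 ^ (n - 1) - 1)"
    unfolding u card_units by (simp only: mult_ac flip: power_mult)
  then show ?thesis
    by (simp only: power_card_units[OF omega_nonzero]) simp
qed

lemma u_power_q: "u ^ q = inverse u"
  using u_power_Suc_q u_nonzero by (simp add: field_simps)

text \<open>Conjugation \<open>x \<mapsto> x ^ q\<close> is inversion on powers of \<open>u\<close>.
  With integer exponents it swaps the two powers of \<open>u\<close> in \<alpha>.\<close>

lemma u_powi_power_q: "(u powi k) ^ q = u powi (- k)"
  by (simp add: power_int_power' u_power_q power_int_inverse power_int_minus power_int_mult
      mult.commute[of k])

lemma u_power_eq_1_iff: "u ^ k = 1 \<longleftrightarrow> (q + 1) dvd k"
proof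
  assume "u ^ k = 1"
  then have "(u ^ (2 * q)) ^ k = 1"
    by (metis power_mult power_one mult.commute)
  then have "(q ^ 2 - 1) dvd (q - 1) * k"
    by (simp only: u_power_2q omega_power_eq_1_iff flip: power_mult)
  then show "(q + 1) dvd k"
    using q_ge_2 unfolding card_units by (subst (asm) dvd_times_left_cancel_iff) auto
next
  assume "(q + 1) dvd k"
  then show "u ^ k = 1"
    using u_power_Suc_q by (metis dvdE power_mult power_one)
qed

lemma range_u: "range (\<lambda>k. u ^ k) = mu (q + 1)"
proof (intro equalityI subsetI)
  fix x assume "x \<in> range (\<lambda>k. u ^ k)"
  then obtain k where "x = u ^ k"
    by blast
  then have "x ^ (q + 1) = (u ^ (q + 1)) ^ k"
    by (simp only: mult.commute flip: power_mult)
  then show "x \<in> mu (q + 1)"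
    by (simp only: mu_def u_power_Suc_q) simp
next
  fix x :: 'a assume "x \<in> mu (q + 1)"
  then have x: "x ^ (q + 1) = 1"
    by (simp add: mu_def)
  then have "x \<noteq> 0"
    by auto
  then obtain k where k: "x = \<omega> ^ k"
    using units_eq by blast
  \<comment> \<open>The order of \<open>\<omega>\<close> forces \<open>q - 1\<close> to divide the
    exponent of every element of \<open>mu (q + 1)\<close>.\<close>
  have "(q - 1) * (q + 1) dvd k * (q + 1)"
    using x unfolding k by (simp only: omega_power_eq_1_iff card_units flip: power_mult)
  then have "(q - 1) dvd k"
    by (subst (asm) dvd_times_right_cancel_iff) auto
  then obtain l where "k = (q - 1) * l" ..
  then have "x = u ^ (2 * q * l)"
    by (simp only: k power_mult[of \<omega>] power_mult[of u "2 * q"] u_power_2q)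
  then show "x \<in> range (\<lambda>k. u ^ k)"
    by blast
qed

section \<open>The subfield of order \<open>q\<close> and the partition into its cosets\<close>

abbreviation F :: "'a set" where "F \<equiv> subfield_of_order q"

lemma zero_in_F: "0 \<in> F"
  using q_ge_2 by (simp add: subfield_of_order_def)

text \<open>This form of membership passes through products, quotients and powers.\<close>

lemma F_nonzero_iff: "y \<in> F - {0} \<longleftrightarrow> y ^ (q - 1) = 1"
proof -
  have "y ^ q = y * y ^ (q - 1)"
    using q_ge_2 by (metis Suc_diff_1 less_le_trans pos2 power_Suc)
  moreover have "y ^ (q - 1) = 1 \<Longrightarrow> y \<noteq> 0"
    using q_ge_2 by (auto simp: power_0_left split: if_splits)
  ultimately show ?thesis
    by (auto simp: subfield_of_order_def)
qed

lemma norm_in_F: "x \<noteq> 0 \<Longrightarrow> x ^ (q + 1) \<in> F - {0}"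
  by (simp only: F_nonzero_iff mult.commute[of "q + 1"] flip: power_mult card_units)
    (rule power_card_units)

lemma mem_mult_coset_iff: "v \<noteq> 0 \<Longrightarrow> x \<in> mult_coset q v \<longleftrightarrow> x / v \<in> F - {0}"
  by (force simp: mult_coset_def)

text \<open>The power \<open>q - 1\<close> kills the factor in \<open>F\<close>, so
  \<open>u ^ ((j - i) * (q - 1)) = 1\<close>. Since \<open>q\<close> is even, \<open>q - 1\<close>
  is coprime to the order \<open>q + 1\<close> of \<open>u\<close>, which then divides
  \<open>j - i \<le> q\<close>.\<close>

lemma coset_exponent_unique:
  assumes "x \<in> mult_coset q (u ^ i)" and "x \<in> mult_coset q (u ^ j)" and "i \<le> j" and "j \<le> q"
  shows "i = j"
proof -
  have "(x / u ^ i) ^ (q - 1) = 1" "(x / u ^ j) ^ (q - 1) = 1" "x \<noteq> 0"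
    using assms(1,2) u_nonzero
    unfolding F_nonzero_iff[symmetric] by (auto simp: mem_mult_coset_iff)
  then have "(u ^ i) ^ (q - 1) = (u ^ j) ^ (q - 1)"
    using u_nonzero by (simp add: power_divide)
  moreover have "u ^ j = u ^ i * u ^ (j - i)"
    using \<open>i \<le> j\<close> by (simp flip: power_add)
  ultimately have "u ^ ((j - i) * (q - 1)) = 1"
    using u_nonzero by (simp add: power_mult_distrib power_mult)
  then have "q + 1 dvd (j - i) * (q - 1)"
    by (simp only: u_power_eq_1_iff)
  moreover have "coprime (q + 1) (q - 1)"
  proof -
    have "q + 1 = 2 + (q - 1)" and odd: "odd (q - 1)"
      using q_ge_2 even_q by auto
    then have "gcd (q + 1) (q - 1) = gcd 2 (q - 1)"
      by (simp only: gcd_add1)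
    then show ?thesis
      using odd by (simp add: coprime_iff_gcd_eq_1[symmetric] del: One_nat_def)
  qed
  ultimately have "q + 1 dvd j - i"
    by (simp only: coprime_dvd_mult_left_iff)
  then show ?thesis
    using assms(3,4) by (auto dest: dvd_imp_le)
qed

lemma disjoint_cosets: "disjoint_family_on (\<lambda>i. mult_coset q (u ^ i)) {0..q}"
proof (unfold disjoint_family_on_def, intro ballI impI)
  fix i j assume ij: "i \<in> {0..q}" "j \<in> {0..q}" "i \<noteq> j"
  have "\<not> (x \<in> mult_coset q (u ^ i) \<and> x \<in> mult_coset q (u ^ j))" for x
    using coset_exponent_unique[of x i j] coset_exponent_unique[of x j i] ij
    by (metis atLeastAtMost_iff nle_le)
  then show "mult_coset q (u ^ i) \<inter> mult_coset q (u ^ j) = {}"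
    by blast
qed

text \<open>Squaring is bijective, with inverse \<open>z \<mapsto> z ^ (q\<^sup>2 / 2)\<close>. Applying this inverse to
  \<open>x\<^sup>2 = x ^ (q + 1) / x ^ (q - 1)\<close> yields the polar decomposition of \<open>x\<close>.\<close>

lemma cosets_cover: "(\<Union>i\<in>{0..q}. mult_coset q (u ^ i)) = - {0}"
proof (intro equalityI subsetI)
  fix x assume "x \<in> (\<Union>i\<in>{0..q}. mult_coset q (u ^ i))"
  then show "x \<in> - {0}"
    using u_nonzero by (auto simp: mem_mult_coset_iff)
next
  fix x :: 'a assume "x \<in> - {0}"
  then have x: "x \<noteq> 0" by simp
  define h where "h = q ^ 2 div 2"
  have "2 * h = q ^ 2"
    using even_q by (simp add: h_def)
  then have "x = (x ^ 2) ^ h"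
    using finite_field_power_card_eq_same[of x] card by (simp flip: power_mult)
  also have "x ^ 2 = x ^ (q + 1) / x ^ (q - 1)"
  proof -
    have "q + 1 = (q - 1) + 2"
      using q_ge_2 by simp
    then show ?thesis
      using x by (simp only: power_add) simp
  qed
  also have "\<dots> ^ h = (x ^ (q + 1)) ^ h / (x ^ (q - 1)) ^ h"
    by (rule power_divide)
  finally have split: "x = (x ^ (q + 1)) ^ h / (x ^ (q - 1)) ^ h" .
  \<comment> \<open>The denominator supplies the factor in \<open>mu (q + 1)\<close>, a power of
    \<open>u\<close> whose exponent is then reduced modulo \<open>q + 1\<close>.\<close>
  have "inverse ((x ^ (q - 1)) ^ h) ^ (q + 1) = inverse ((x ^ (q ^ 2 - 1)) ^ h)"
    unfolding card_units by (simp only: power_inverse mult_ac flip: power_mult)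
  then have "inverse ((x ^ (q - 1)) ^ h) \<in> mu (q + 1)"
    by (simp only: power_card_units[OF x] mu_def) simp
  then obtain k where k: "inverse ((x ^ (q - 1)) ^ h) = u ^ k"
    using range_u by blast
  also have "u ^ k = u ^ ((q + 1) * (k div (q + 1)) + k mod (q + 1))"
    by (simp only: mult_div_mod_eq)
  also have "\<dots> = u ^ (k mod (q + 1))"
    by (subst power_add, subst power_mult, subst u_power_Suc_q) simp
  finally have polar: "inverse ((x ^ (q - 1)) ^ h) = u ^ (k mod (q + 1))" .
  have eq: "x / u ^ (k mod (q + 1)) = (x ^ (q + 1)) ^ h"
    by (rule iffD2[OF nonzero_divide_eq_eq split[unfolded divide_inverse polar]])
      (simp add: u_nonzero)
  \<comment> \<open>The numerator is a power of the norm of \<open>x\<close>, hence the factor in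
    \<open>F\<close>.\<close>
  have "((x ^ (q + 1)) ^ h) ^ (q - 1) = ((x ^ (q + 1)) ^ (q - 1)) ^ h"
    by (simp only: mult_ac flip: power_mult)
  also have "\<dots> = 1"
    using norm_in_F[OF x] unfolding F_nonzero_iff by (simp only: power_one)
  finally have "x / u ^ (k mod (q + 1)) \<in> F - {0}"
    by (simp only: F_nonzero_iff eq)
  then have "x \<in> mult_coset q (u ^ (k mod (q + 1)))"
    using u_nonzero by (simp add: mem_mult_coset_iff)
  moreover have "k mod (q + 1) \<in> {0..q}"
    using mod_less_divisor[of "q + 1" k] by simp
  ultimately show "x \<in> (\<Union>i\<in>{0..q}. mult_coset q (u ^ i))"
    by blast
qed

text \<open>The partition of the \<open>q ^ 2 - 1\<close> units into \<open>q + 1\<close> cosets,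
  each of the size of \<open>F - {0}\<close>, determines that size.\<close>

lemma card_F: "card F = q"
proof -
  have "card (\<Union>i\<in>{0..q}. mult_coset q (u ^ i)) = (\<Sum>i\<in>{0..q}. card (mult_coset q (u ^ i)))"
    using disjoint_cosets by (intro card_UN_disjoint) (auto simp: disjoint_family_on_def)
  also have "\<dots> = (\<Sum>i\<in>{0..q}. card (F - {0}))"
    unfolding mult_coset_def using u_nonzero by (intro sum.cong card_image inj_onI) simp_all
  finally have "q ^ 2 - 1 = (q + 1) * card (F - {0})"
    by (simp add: cosets_cover Compl_eq_Diff_UNIV card)
  then have "(q - 1) * (q + 1) = card (F - {0}) * (q + 1)"
    by (simp only: card_units mult.commute)
  then have "card (F - {0}) = q - 1"
    by (subst (asm) mult_cancel2) simp
  then show ?thesis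
    using zero_in_F q_ge_2 card_gt_0_iff[of F] by (auto simp: card_Diff_singleton)
qed

section \<open>Additive characters of the subfield\<close>

text \<open>Transitivity of the trace: since \<open>2 ^ (m + j) = q * 2 ^ j\<close> and
  \<open>y ^ q = y\<close>, the second half of the sum is the first half with \<open>c ^ q\<close>
  in place of \<open>c\<close>.\<close>

lemma trace_sum_F:
  assumes "y \<in> F"
  shows "(\<Sum>j<n. (c * y) ^ (2 ^ j)) = (\<Sum>j<m. ((c + c ^ q) * y) ^ (2 ^ j))"
proof -
  have yq: "y ^ q = y"
    using assms by (simp add: subfield_of_order_def)
  have "(\<Sum>j<n. (c * y) ^ (2 ^ j)) = (\<Sum>j<m. (c * y) ^ (2 ^ j)) + (\<Sum>j<m. (c * y) ^ (2 ^ (m + j)))"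
    using sum.atLeastLessThan_concat[of 0 m "m + m" "\<lambda>j. (c * y) ^ (2 ^ j)"]
      sum.shift_bounds_nat_ivl[of "\<lambda>j. (c * y) ^ (2 ^ j)" 0 m m]
    by (simp add: n lessThan_atLeast0 add.commute mult_2)
  also have "(\<Sum>j<m. (c * y) ^ (2 ^ (m + j))) = (\<Sum>j<m. (c ^ q * y) ^ (2 ^ j))"
    by (simp add: power_add power_mult power_mult_distrib yq flip: q)
  finally show ?thesis
    by (simp add: distrib_right add_power_two_power[OF char] sum.distrib)
qed

lemma sum_character_F:
  "(\<Sum>y\<in>F. bit_sign (abs_trace n (c * y))) = (if c + c ^ q = 0 then int q else 0)"
proof (cases "c + c ^ q = 0")
  case True
  then have "abs_trace n (c * y) = 0" if "y \<in> F" for y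
    using trace_sum_F[OF that, of c] by (simp add: abs_trace_def power_0_left)
  then show ?thesis
    using True by (simp add: card_F)
next
  case False
  define d where "d = c + c ^ q"
  \<comment> \<open>\<open>P\<close> is the trace form \<open>y \<mapsto> Tr(d y)\<close> of the
    subfield as a polynomial. Its linear coefficient \<open>d\<close> makes it nonzero, and its
    degree, at most \<open>2 ^ (m - 1) < q\<close>, allows too few roots to cover
    \<open>F\<close>.\<close>
  define P where "P = (\<Sum>j<m. monom (d ^ (2 ^ j)) (2 ^ j))"
  have poly_P: "poly P y = (\<Sum>j<m. (d * y) ^ (2 ^ j))" for y
    by (simp add: P_def poly_sum poly_monom power_mult_distrib)
  have "coeff P 1 = (\<Sum>j<m. if j = 0 then d else 0)"
    unfolding P_def coeff_sum by (intro sum.cong) auto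
  then have "P \<noteq> 0"
    using False m by (auto simp: d_def)
  have "degree P \<le> 2 ^ (m - 1)"
    unfolding P_def
    by (intro degree_sum_le) (auto intro!: order.trans[OF degree_monom_le] power_increasing)
  also have "\<dots> < q"
    using m by (simp add: q)
  finally have "degree P < card F"
    by (simp add: card_F)
  have "\<exists>z\<in>F. poly P z \<noteq> 0"
  proof (rule ccontr)
    assume "\<not> (\<exists>z\<in>F. poly P z \<noteq> 0)"
    then have "card F \<le> card {z. poly P z = 0}"
      by (intro card_mono) auto
    also have "\<dots> \<le> degree P"
      by (rule card_poly_roots_bound) fact
    finally show False
      using \<open>degree P < card F\<close> by simp
  qed
  then obtain z where z: "z \<in> F" "poly P z \<noteq> 0" ..
  then have "abs_trace n (c * z) = 1"
    using trace_sum_F[OF z(1), of c] by (simp add: abs_trace_def poly_P d_def)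
  moreover have "x + y \<in> F" "- x \<in> F" if "x \<in> F" "y \<in> F" for x y
    using that by (simp_all add: subfield_of_order_def add_power_q uminus_CHAR_2[OF char])
  ultimately have "(\<Sum>y\<in>F. bit_sign (abs_trace n (c * y))) = 0"
    by (intro sum_bit_sign_additive[where z = z])
      (auto simp: z distrib_left abs_trace_add[OF card_2 n_pos])
  then show ?thesis
    using False by simp
qed

section \<open>The Walsh sum over one coset\<close>

lemma coset_contribution:
  assumes f: "\<And>x. x \<in> mult_coset q (u ^ i) \<Longrightarrow> f x = abs_trace n (a * x ^ (s * (q - 1) + 1))"
    and \<alpha>: "\<alpha> = a * u powi (int i * (1 - 2 * int s)) + a ^ q * u powi (int i * (2 * int s - 1))"
  shows "(\<Sum>x\<in>mult_coset q (u ^ i). bit_sign (f x + abs_trace n (b * x))) =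
    int q * (if b * u ^ i + b ^ q * u powi (- int i) = \<alpha> then 1 else 0) - 1"
proof -
  define c where "c = a * u powi (int i * (1 - 2 * int s)) + b * u ^ i"
  have u_pow: "(u ^ i) ^ (s * (q - 1) + 1) = u powi (int i * (1 - 2 * int s))"
  proof -
    \<comment> \<open>From \<open>u ^ (q + 1) = 1\<close>; this is where the exponent
      \<open>1 - 2 * int s\<close> in \<alpha> comes from.\<close>
    have "u ^ (q - 1) = u powi (- 2)"
    proof -
      have "u ^ (q - 1) * u ^ 2 = u ^ (q + 1)"
        using q_ge_2 by (simp flip: power_add)
      then show ?thesis
        using u_nonzero u_power_Suc_q by (simp add: power_int_minus field_simps)
    qed
    then have "u ^ (s * (q - 1)) = u powi (- 2 * int s)"
      by (simp only: power_int_power' power_mult mult.commute[of s])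
    then have "u ^ (s * (q - 1) + 1) = u powi (- 2 * int s + 1)"
      by (simp only: power_add power_one_right power_int_add_1[OF disjI1[OF u_nonzero]])
    moreover have "(u ^ i) ^ (s * (q - 1) + 1) = (u ^ (s * (q - 1) + 1)) ^ i"
      by (simp only: mult.commute flip: power_mult)
    moreover have "(- 2 * int s + 1) * int i = int i * (1 - 2 * int s)"
      by (simp add: algebra_simps)
    ultimately show ?thesis
      by (simp only: power_int_power')
  qed
  have val: "f (u ^ i * y) + abs_trace n (b * (u ^ i * y)) = abs_trace n (c * y)" if y: "y \<in> F - {0}" for y
  proof -
    have "y ^ (q - 1) = 1"
      using y by (simp only: F_nonzero_iff)
    \<comment> \<open>The exponent is 1 modulo \<open>q - 1\<close>, which makes \<open>f\<close>
      linear in \<open>y\<close> along the coset.\<close>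
    then have "y ^ (s * (q - 1) + 1) = y"
      by (simp add: power_mult mult.commute[of s])
    then have "(u ^ i * y) ^ (s * (q - 1) + 1) = u powi (int i * (1 - 2 * int s)) * y"
      by (simp only: power_mult_distrib u_pow)
    moreover have "u ^ i * y \<in> mult_coset q (u ^ i)"
      using y by (auto simp: mult_coset_def)
    ultimately show ?thesis
      by (simp only: f c_def distrib_right mult.assoc flip: abs_trace_add[OF card_2 n_pos])
  qed
  have "(u ^ i) ^ q = u powi (- int i)"
    using u_powi_power_q[of "int i"] by simp
  then have "c ^ q = a ^ q * u powi (int i * (2 * int s - 1)) + b ^ q * u powi (- int i)"
    by (simp add: c_def add_power_q power_mult_distrib u_powi_power_q algebra_simps)
  then have "c + c ^ q = (b * u ^ i + b ^ q * u powi (- int i)) + \<alpha>"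
    by (simp add: c_def \<alpha>)
  \<comment> \<open>In characteristic two a vanishing sum means equal summands, so the condition on
    the relative trace of \<open>c\<close> becomes the one defining \<open>T\<close>.\<close>
  then have zero_iff: "c + c ^ q = 0 \<longleftrightarrow> b * u ^ i + b ^ q * u powi (- int i) = \<alpha>"
    by (simp only: add_eq_0_iff_CHAR_2[OF char])
  have "(\<Sum>x\<in>mult_coset q (u ^ i). bit_sign (f x + abs_trace n (b * x))) =
      (\<Sum>y\<in>F - {0}. bit_sign (f (u ^ i * y) + abs_trace n (b * (u ^ i * y))))"
    unfolding mult_coset_def using u_nonzero by (subst sum.reindex) (auto intro: inj_onI)
  also have "\<dots> = (\<Sum>y\<in>F - {0}. bit_sign (abs_trace n (c * y)))"
    by (rule sum.cong) (simp_all only: val)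
  \<comment> \<open>The coset omits \<open>y = 0\<close>, whose sign is 1; this is the source of the
    \<open>- 1\<close> in each contribution.\<close>
  also have "\<dots> = (\<Sum>y\<in>F. bit_sign (abs_trace n (c * y))) - 1"
    using zero_in_F by (simp add: sum_diff1 abs_trace_def power_0_left)
  finally show ?thesis
    by (simp add: sum_character_F zero_iff)
qed

end

section \<open>The Walsh transform and bentness\<close>

theorem theorem3p6:
  fixes m n q :: nat
    and \<omega> u :: "'a::finite_field"
    and a \<alpha> :: "nat \<Rightarrow> 'a"
    and s :: "nat \<Rightarrow> nat"
    and f :: "'a \<Rightarrow> bit"
    and T :: "nat \<Rightarrow> 'a \<Rightarrow> int"
  assumes m: "m \<ge> 1"
    and n: "n = 2 * m"
    and q: "q = 2 ^ m"
    and card: "CARD('a) = q ^ 2"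
    and \<omega>: "primitive_element \<omega>"
    and u: "u = \<omega> ^ ((q - 1) * (2 ^ (n - 1) - 1))"
    and s: "\<And>i. i \<le> q \<Longrightarrow> s i \<le> q"
    and f_0: "f 0 = 0"
    and f: "\<And>i x. i \<le> q \<Longrightarrow> x \<in> mult_coset q (u ^ i) \<Longrightarrow>
              f x = abs_trace n (a i * x ^ (s i * (q - 1) + 1))"
    and \<alpha>: "\<And>i. i \<le> q \<Longrightarrow>
              \<alpha> i = a i * u powi (int i * (1 - 2 * int (s i)))
                    + a i ^ q * u powi (int i * (2 * int (s i) - 1))"
    and T: "\<And>i b. i \<le> q \<Longrightarrow>
              T i b = (if b * u ^ i + b ^ q * u powi (- int i) = \<alpha> i then 1 else 0)"
  shows "range (\<lambda>k::nat. u ^ k) = mu (q + 1) \<and>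
         disjoint_family_on (\<lambda>i. mult_coset q (u ^ i)) {0..q} \<and>
         (\<Union>i\<in>{0..q}. mult_coset q (u ^ i)) = - {0} \<and>
         (\<forall>b. walsh n f b = int q * ((\<Sum>i=0..q. T i b) - 1)) \<and>
         (bent n f \<longleftrightarrow> (\<forall>b. (\<Sum>i=0..q. T i b) \<in> {0, 2}))"
proof -
  interpret quadratic_extension m q n \<omega> u
    by unfold_locales fact+
  have walsh: "walsh n f b = int q * ((\<Sum>i=0..q. T i b) - 1)" for b
  proof -
    let ?g = "\<lambda>x. bit_sign (f x + abs_trace n (b * x))"
    have "walsh n f b = ?g 0 + (\<Sum>x\<in>- {0}. ?g x)"
      unfolding walsh_eq_sum_bit_sign Compl_eq_Diff_UNIV by (rule sum.remove) simp_all
    also have "(\<Sum>x\<in>- {0}. ?g x) = (\<Sum>i=0..q. \<Sum>x\<in>mult_coset q (u ^ i). ?g x)"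
      unfolding cosets_cover[symmetric] using disjoint_cosets
      by (intro sum.UNION_disjoint) (auto simp: disjoint_family_on_def)
    also have "\<dots> = (\<Sum>i=0..q. int q * T i b - 1)"
      by (rule sum.cong[OF refl]) (subst coset_contribution[OF f \<alpha>]; simp add: T)
    \<comment> \<open>The \<open>q + 1\<close> cosets subtract \<open>q + 1\<close> in total; the
      point 0 gives back 1, which leaves \<open>- q\<close>.\<close>
    also have "\<dots> = int q * (\<Sum>i=0..q. T i b) - (int q + 1)"
      by (simp add: sum_subtractf sum_distrib_left)
    also have "?g 0 = 1"
      by (simp add: f_0 abs_trace_def power_0_left)
    finally show ?thesis
      by (simp add: algebra_simps)
  qed
  have "2 powr (real n / 2) = real q"
    by (simp add: n q powr_realpow)
  moreover have "\<bar>real_of_int (walsh n f b)\<bar> = real q \<longleftrightarrow> (\<Sum>i=0..q. T i b) \<in> {0, 2}" for b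
  proof -
    have "\<bar>real_of_int (walsh n f b)\<bar> = real q \<longleftrightarrow> real q * real_of_int \<bar>(\<Sum>i=0..q. T i b) - 1\<bar> = real q * real_of_int 1"
      by (simp only: walsh of_int_mult abs_mult of_int_abs) simp
    also have "\<dots> \<longleftrightarrow> \<bar>(\<Sum>i=0..q. T i b) - 1\<bar> = 1"
      using q_ge_2 by (simp only: mult_cancel_left of_int_eq_iff) simp
    also have "\<dots> \<longleftrightarrow> (\<Sum>i=0..q. T i b) \<in> {0, 2}"
      by auto
    finally show ?thesis .
  qed
  ultimately have "bent n f \<longleftrightarrow> (\<forall>b. (\<Sum>i=0..q. T i b) \<in> {0, 2})"
    by (simp only: bent_def)
  then show ?thesis
    using range_u disjoint_cosets cosets_cover walsh by blast
qed

end
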